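(* Let $T$ be a rooted tree with $n\ge 2$ vertices. Then $$\rho_L(T)\ge\sqrt{\frac{\sum_{1\le i\le n}Q_i^2}{\sum_{1\le j\le n}L_j^2}}=\sqrt{\frac{\sum_{1\le i\le n}Q_i^2}{\sum_{1\le i\le n}Q_i}},$$ where $Q_i=\sum_{1\le j\le n} l_{ij}L_j$.
   Context: A rooted tree is a finite tree with a distinguished vertex (the root). The level $l(v)$ of a vertex $v$ is its distance from the root. For a rooted tree $T$ with vertices $v_1,\dots,v_n$, the level matrix $L(T)=(l_{ij})$ is the $n\times n$ real symmetric matrix with $l_{ij}=|l(v_i)-l(v_j)|$. The level spectral radius $\rho_L(T)$ is the largest absolute value of an eigenvalue of $L(T)$. Set $L_i=L_i(T)=\sum_{j=1}^n l_{ij}$ (the $i$-th row sum). *)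

theory Defs
  imports
    "Graph_Theory.Digraph_Component"
    "Graph_Theory.Shortest_Path"
    "Jordan_Normal_Form.Spectral_Radius"
begin

text \<open>
  Undirected finite simple graphs are symmetric digraphs (locale \<^locale>\<open>graph\<close>), so every edge
  \<open>u, v\<close> also gives the closed walk \<open>u, v, u\<close>, which \<^const>\<open>pre_digraph.cycle\<close> counts as a cycle of
  length 2. Since there are no loops and no parallel arcs, the cycles of the undirected graph are
  exactly those of length at least 3. The predicate \<open>tree\<close> of the graph library is not usable here:
  it excludes all directed cycles, so no symmetric digraph with an edge satisfies it.
\<close>

definition undirected_tree :: "('a, 'b) pre_digraph \<Rightarrow> bool" where
  "undirected_tree T \<longleftrightarrow>
     graph T \<and> Digraph_Component.connected T \<and> \<not> (\<exists>p. pre_digraph.cycle T p \<and> 3 \<le> length p)"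

definition rooted_tree :: "('a, 'b) pre_digraph \<Rightarrow> 'a \<Rightarrow> bool" where
  "rooted_tree T r \<longleftrightarrow> undirected_tree T \<and> r \<in> verts T"

text \<open>With unit arc weights the cost of a walk is its length, and \<open>\<mu>\<close> is the graph distance.\<close>

definition level :: "('a, 'b) pre_digraph \<Rightarrow> 'a \<Rightarrow> 'a \<Rightarrow> real" where
  "level T r x = real_of_ereal (wf_digraph.\<mu> T (\<lambda>_. 1) r x)"

text \<open>The function \<open>v\<close> enumerates the vertices as \<open>v 0, \<dots>, v (n - 1)\<close>.\<close>

definition level_matrix ::
  "('a, 'b) pre_digraph \<Rightarrow> 'a \<Rightarrow> (nat \<Rightarrow> 'a) \<Rightarrow> nat \<Rightarrow> real mat" where
  "level_matrix T r v n = mat n n (\<lambda>(i, j). \<bar>level T r (v i) - level T r (v j)\<bar>)"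

definition level_spectral_radius ::
  "('a, 'b) pre_digraph \<Rightarrow> 'a \<Rightarrow> (nat \<Rightarrow> 'a) \<Rightarrow> nat \<Rightarrow> real" where
  "level_spectral_radius T r v n = spectral_radius (map_mat complex_of_real (level_matrix T r v n))"

definition level_row_sum ::
  "('a, 'b) pre_digraph \<Rightarrow> 'a \<Rightarrow> (nat \<Rightarrow> 'a) \<Rightarrow> nat \<Rightarrow> nat \<Rightarrow> real" where
  "level_row_sum T r v n i = (\<Sum>j<n. level_matrix T r v n $$ (i, j))"

definition level_Q ::
  "('a, 'b) pre_digraph \<Rightarrow> 'a \<Rightarrow> (nat \<Rightarrow> 'a) \<Rightarrow> nat \<Rightarrow> nat \<Rightarrow> real" where
  "level_Q T r v n i = (\<Sum>j<n. level_matrix T r v n $$ (i, j) * level_row_sum T r v n j)"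

end

theory Submission
  imports Defs
begin

text \<open>
  For a real symmetric matrix \<open>A\<close> of spectral radius \<open>\<rho>\<close>, the Euclidean norm satisfies
  \<open>\<parallel>A x\<parallel> \<le> \<rho> \<parallel>x\<parallel>\<close>. Applied to the level matrix and the vector \<open>L\<close> of its row sums, whose
  image is the vector \<open>Q\<close>, this is the inequality of the theorem. The two radicands agree because
  \<open>L\<close> is the image of the all-ones vector \<open>e\<close>, so symmetry gives
  \<open>\<Sum>Q\<^sub>i = \<langle>e, A L\<rangle> = \<langle>A e, L\<rangle> = \<parallel>L\<parallel>\<^sup>2\<close>.

  The norm inequality is derived from the growth of matrix powers instead of an orthonormal
  eigenbasis. By scaling, it suffices to show \<open>\<parallel>A x\<parallel> \<le> \<parallel>x\<parallel>\<close> when \<open>\<rho> < 1\<close>. In that case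
  the Jordan normal form shows that the powers \<open>A\<^sup>k\<close> are bounded, hence so is the sequence
  \<open>b k = \<parallel>A\<^sup>k x\<parallel>\<^sup>2\<close> (\<open>spectral_radius_less_1_orbit_bounded\<close>). Symmetry makes this sequence
  convex: with \<open>y\<^sub>k = A\<^sup>k x\<close> one has \<open>\<langle>y\<^sub>k, y\<^sub>k\<^sub>+\<^sub>2\<rangle> = \<parallel>y\<^sub>k\<^sub>+\<^sub>1\<parallel>\<^sup>2\<close>, so expanding
  \<open>0 \<le> \<parallel>y\<^sub>k\<^sub>+\<^sub>2 - y\<^sub>k\<parallel>\<^sup>2\<close> yields \<open>2 b (k + 1) \<le> b k + b (k + 2)\<close>
  (\<open>symmetric_orbit_norm_convex\<close>). A bounded convex sequence cannot take an upward step, so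
  \<open>b 1 \<le> b 0\<close>, which is the claim.
\<close>

lemma smult_mat_mult_vec:
  fixes A :: "'a :: comm_semiring_0 mat"
  assumes "A \<in> carrier_mat m n" and "x \<in> carrier_vec n"
  shows "(c \<cdot>\<^sub>m A) *\<^sub>v x = c \<cdot>\<^sub>v (A *\<^sub>v x)"
  using assms by (intro eq_vecI) (auto simp: scalar_prod_def sum_distrib_left mult.assoc)

lemma pow_Suc_mult_mat_vec:
  fixes A :: "'a :: comm_semiring_1 mat"
  assumes A: "A \<in> carrier_mat n n" and x: "x \<in> carrier_vec n"
  shows "(A ^\<^sub>m Suc k) *\<^sub>v x = A *\<^sub>v ((A ^\<^sub>m k) *\<^sub>v x)"
  using x
proof (induction k arbitrary: x)
  case (Suc k)
  have "(A ^\<^sub>m Suc (Suc k)) *\<^sub>v x = (A ^\<^sub>m Suc k) *\<^sub>v (A *\<^sub>v x)"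
    using assoc_mult_mat_vec[OF pow_carrier_mat[OF A, of "Suc k"] A Suc.prems] by simp
  also have "\<dots> = A *\<^sub>v ((A ^\<^sub>m k) *\<^sub>v (A *\<^sub>v x))"
    using Suc.IH[of "A *\<^sub>v x"] A Suc.prems by (metis mult_mat_vec_carrier)
  also have "(A ^\<^sub>m k) *\<^sub>v (A *\<^sub>v x) = (A ^\<^sub>m Suc k) *\<^sub>v x"
    using assoc_mult_mat_vec[OF pow_carrier_mat[OF A, of k] A Suc.prems] by simp
  finally show ?case .
qed (use A in simp)

lemma symmetric_mat_scalar_prod:
  fixes A :: "real mat"
  assumes A: "A \<in> carrier_mat n n" and sym: "transpose_mat A = A"
    and x: "x \<in> carrier_vec n" and y: "y \<in> carrier_vec n"
  shows "(A *\<^sub>v x) \<bullet> y = x \<bullet> (A *\<^sub>v y)"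
  using transpose_vec_mult_scalar[OF A y x] sym
  by (metis A comm_scalar_prod mult_mat_vec_carrier x y)

lemma scalar_prod_self_nonneg: "0 \<le> x \<bullet> (x :: real vec)"
  unfolding scalar_prod_def by (simp add: sum_nonneg)

text \<open>
  The increments of a convex sequence are nondecreasing, so each is at least the initial one.
\<close>

lemma convex_sequence_linear_growth:
  fixes b :: "nat \<Rightarrow> real"
  assumes conv: "\<And>k. 2 * b (Suc k) \<le> b k + b (Suc (Suc k))"
  shows "b 0 + real k * (b 1 - b 0) \<le> b k"
proof -
  have step: "b 1 - b 0 \<le> b (Suc k) - b k" for k
  proof (induction k)
    case (Suc k)
    then show ?case using conv[of k] by simp
  qed simp
  show ?thesis
  proof (induction k)
    case (Suc k)
    then show ?case using step[of k] by (simp add: algebra_simps)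
  qed simp
qed

lemma bounded_convex_sequence_descends:
  fixes b :: "nat \<Rightarrow> real"
  assumes conv: "\<And>k. 2 * b (Suc k) \<le> b k + b (Suc (Suc k))"
    and bound: "\<And>k. b k \<le> K"
  shows "b 1 \<le> b 0"
proof (rule ccontr)
  assume "\<not> b 1 \<le> b 0"
  then obtain k where "K - b 0 < real k * (b 1 - b 0)"
    using reals_Archimedean3[of "b 1 - b 0"] by auto
  with convex_sequence_linear_growth[of b, OF conv, of k] bound[of k] show False
    by linarith
qed

text \<open>
  Expand \<open>0 \<le> \<parallel>A\<^sup>2 x - x\<parallel>\<^sup>2\<close>; by symmetry the mixed term \<open>\<langle>x, A\<^sup>2 x\<rangle>\<close> is \<open>\<parallel>A x\<parallel>\<^sup>2\<close>.
  With \<open>A\<^sup>k x\<close> in place of \<open>x\<close> this is the convexity of \<open>k \<mapsto> \<parallel>A\<^sup>k x\<parallel>\<^sup>2\<close> at \<open>k + 1\<close>.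
\<close>

lemma symmetric_orbit_norm_convex:
  fixes A :: "real mat"
  assumes A: "A \<in> carrier_mat n n" and sym: "transpose_mat A = A"
    and x: "x \<in> carrier_vec n"
  shows "2 * ((A *\<^sub>v x) \<bullet> (A *\<^sub>v x))
           \<le> x \<bullet> x + (A *\<^sub>v (A *\<^sub>v x)) \<bullet> (A *\<^sub>v (A *\<^sub>v x))"
proof -
  define z where "z = A *\<^sub>v (A *\<^sub>v x)"
  have z: "z \<in> carrier_vec n" using A x by (simp add: z_def)
  have "0 \<le> (z - x) \<bullet> (z - x)" by (rule scalar_prod_self_nonneg)
  also have "\<dots> = z \<bullet> z - 2 * (x \<bullet> z) + x \<bullet> x"
    using x z by (simp add: scalar_prod_minus_distrib[of _ n] minus_scalar_prod_distrib[of _ n]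
        comm_scalar_prod[of z n x])
  also have "x \<bullet> z = (A *\<^sub>v x) \<bullet> (A *\<^sub>v x)"
    using symmetric_mat_scalar_prod[OF A sym x, of "A *\<^sub>v x"] A x by (simp add: z_def)
  finally show ?thesis by (simp add: z_def)
qed

text \<open>
  By the Jordan normal form, the entries of the complex powers of \<open>A\<close> are bounded uniformly in the
  exponent; the powers are themselves real, so the bound carries over to the orbit of \<open>x\<close>.
\<close>

lemma spectral_radius_less_1_orbit_bounded:
  fixes A :: "real mat"
  assumes A: "A \<in> carrier_mat n n" and x: "x \<in> carrier_vec n"
    and sr: "spectral_radius (map_mat complex_of_real A) < 1"
  obtains K where "\<And>k. ((A ^\<^sub>m k) *\<^sub>v x) \<bullet> ((A ^\<^sub>m k) *\<^sub>v x) \<le> K"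
proof -
  let ?C = "map_mat complex_of_real A"
  have C: "?C \<in> carrier_mat n n" using A by simp
  obtain c where c: "\<And>k. norm_bound (?C ^\<^sub>m k) c"
    using spectral_radius_jnf_norm_bound_less_1_upper_triangular[OF C sr] by blast
  have entry: "\<bar>(A ^\<^sub>m k) $$ (i, j)\<bar> \<le> c" if "i < n" "j < n" for i j k
  proof -
    have "norm ((?C ^\<^sub>m k) $$ (i, j)) \<le> c"
      using c[of k] that C unfolding norm_bound_def by (simp add: pow_mat_dim_square[OF C])
    moreover have "?C ^\<^sub>m k = map_mat complex_of_real (A ^\<^sub>m k)"
      by (rule of_real_hom.mat_hom_pow[OF A, symmetric])
    ultimately show ?thesis using that pow_mat_dim_square[OF A, of k] by simp
  qed
  define M where "M = c * (\<Sum>j<n. \<bar>x $ j\<bar>)"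
  have coord: "((A ^\<^sub>m k) *\<^sub>v x) $ i * ((A ^\<^sub>m k) *\<^sub>v x) $ i \<le> M\<^sup>2" if i: "i < n" for i k
  proof -
    have "((A ^\<^sub>m k) *\<^sub>v x) $ i = (\<Sum>j<n. (A ^\<^sub>m k) $$ (i, j) * x $ j)"
      using i x pow_mat_dim_square[OF A, of k]
      by (simp add: scalar_prod_def atLeast0LessThan)
    also have "\<bar>\<dots>\<bar> \<le> (\<Sum>j<n. \<bar>(A ^\<^sub>m k) $$ (i, j) * x $ j\<bar>)" by (rule sum_abs)
    also have "\<dots> \<le> M"
      unfolding M_def sum_distrib_left abs_mult
      by (intro sum_mono mult_right_mono entry) (use i in auto)
    finally show ?thesis
      by (metis abs_ge_zero power2_abs power2_eq_square power_mono)
  qed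
  have "((A ^\<^sub>m k) *\<^sub>v x) \<bullet> ((A ^\<^sub>m k) *\<^sub>v x) \<le> real n * M\<^sup>2" for k
  proof -
    have "((A ^\<^sub>m k) *\<^sub>v x) \<bullet> ((A ^\<^sub>m k) *\<^sub>v x)
        = (\<Sum>i<n. ((A ^\<^sub>m k) *\<^sub>v x) $ i * ((A ^\<^sub>m k) *\<^sub>v x) $ i)"
      using pow_mat_dim_square[OF A, of k] by (simp add: scalar_prod_def atLeast0LessThan)
    also have "\<dots> \<le> (\<Sum>i<n. M\<^sup>2)" by (intro sum_mono coord) simp
    finally show ?thesis by simp
  qed
  then show thesis by (rule that)
qed

lemma symmetric_spectral_radius_less_1_contraction:
  fixes A :: "real mat"
  assumes A: "A \<in> carrier_mat n n" and sym: "transpose_mat A = A"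
    and sr: "spectral_radius (map_mat complex_of_real A) < 1"
    and x: "x \<in> carrier_vec n"
  shows "(A *\<^sub>v x) \<bullet> (A *\<^sub>v x) \<le> x \<bullet> x"
proof -
  define y where "y k = (A ^\<^sub>m k) *\<^sub>v x" for k
  have y0: "y 0 = x" using A x by (simp add: y_def)
  have y: "y k \<in> carrier_vec n" for k
    using A x by (simp add: y_def pow_carrier_mat[of A n] mult_mat_vec_carrier[of _ n n])
  have ySuc: "y (Suc k) = A *\<^sub>v y k" for k
    unfolding y_def by (rule pow_Suc_mult_mat_vec[OF A x])
  obtain K where "\<And>k. y k \<bullet> y k \<le> K"
    unfolding y_def using spectral_radius_less_1_orbit_bounded[OF A x sr] by metis
  then have "y 1 \<bullet> y 1 \<le> y 0 \<bullet> y 0"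
    by (intro bounded_convex_sequence_descends[of "\<lambda>k. y k \<bullet> y k" K])
      (auto simp: ySuc intro: symmetric_orbit_norm_convex[OF A sym y])
  then show ?thesis using ySuc[of 0] by (simp add: y0)
qed

lemma spectral_radius_scaled_less_1:
  fixes C :: "complex mat"
  assumes C: "C \<in> carrier_mat n n" and n: "0 < n"
    and c: "0 < c" "spectral_radius C < c"
  shows "spectral_radius (complex_of_real (1 / c) \<cdot>\<^sub>m C) < 1"
proof -
  let ?B = "complex_of_real (1 / c) \<cdot>\<^sub>m C"
  have B: "?B \<in> carrier_mat n n" using C by simp
  obtain k where k: "eigenvalue ?B k" and sr: "spectral_radius ?B = norm k"
    using spectral_radius_mem_max(1)[OF B n] unfolding spectrum_def by auto
  obtain v where v: "v \<in> carrier_vec n" "v \<noteq> 0\<^sub>v n" and Bv: "?B *\<^sub>v v = k \<cdot>\<^sub>v v"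
    using k C unfolding eigenvalue_def eigenvector_def by auto
  have "C = complex_of_real c \<cdot>\<^sub>m ?B" using c by (intro eq_matI) auto
  then have "C *\<^sub>v v = complex_of_real c \<cdot>\<^sub>v (?B *\<^sub>v v)"
    by (metis B smult_mat_mult_vec v(1))
  then have "C *\<^sub>v v = (complex_of_real c * k) \<cdot>\<^sub>v v"
    by (simp only: Bv smult_smult_assoc)
  then have "eigenvalue C (complex_of_real c * k)"
    using v C unfolding eigenvalue_def eigenvector_def by auto
  then have "norm (complex_of_real c * k) \<le> spectral_radius C"
    by (intro spectral_radius_mem_max(2)[OF C n]) (auto simp: spectrum_def)
  then have "c * norm k \<le> spectral_radius C" using c by (simp add: norm_mult)
  then have "c * norm k < c * 1" using c(2) by linarith
  then show ?thesis using c sr by simp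
qed

text \<open>
  The scaled matrix \<open>A / c\<close> is a contraction for every \<open>c > \<rho>\<close>; letting \<open>c\<close> tend to \<open>\<rho>\<close> gives
  the bound. For \<open>x = 0\<close> the quotient is \<open>0 / 0 = 0\<close>, and the inequality then says that the
  spectral radius is nonnegative, which is where \<open>0 < n\<close> matters: the maximum defining the
  spectral radius has to range over a nonempty spectrum.
\<close>

theorem symmetric_spectral_radius_lower_bound:
  fixes A :: "real mat"
  assumes A: "A \<in> carrier_mat n n" and sym: "transpose_mat A = A" and n: "0 < n"
    and x: "x \<in> carrier_vec n"
  shows "sqrt ((A *\<^sub>v x) \<bullet> (A *\<^sub>v x) / (x \<bullet> x))
           \<le> spectral_radius (map_mat complex_of_real A)"
proof (rule dense_ge)
  let ?C = "map_mat complex_of_real A"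
  fix c assume c: "spectral_radius ?C < c"
  have C: "?C \<in> carrier_mat n n" using A by simp
  have "0 \<le> spectral_radius ?C"
    using spectral_radius_mem_max(1)[OF C n] by auto
  with c have c0: "0 < c" by linarith
  define B where "B = (1 / c) \<cdot>\<^sub>m A"
  have B: "B \<in> carrier_mat n n" using A by (simp add: B_def)
  have "transpose_mat B = (1 / c) \<cdot>\<^sub>m transpose_mat A"
    unfolding B_def by (intro eq_matI) auto
  then have symB: "transpose_mat B = B" by (simp add: sym B_def)
  have "map_mat complex_of_real B = complex_of_real (1 / c) \<cdot>\<^sub>m ?C"
    unfolding B_def by (intro eq_matI) auto
  then have srB: "spectral_radius (map_mat complex_of_real B) < 1"
    using spectral_radius_scaled_less_1[OF C n c0 c] by simp
  have "B *\<^sub>v x = (1 / c) \<cdot>\<^sub>v (A *\<^sub>v x)"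
    unfolding B_def by (rule smult_mat_mult_vec[OF A x])
  then have "(B *\<^sub>v x) \<bullet> (B *\<^sub>v x) = (A *\<^sub>v x) \<bullet> (A *\<^sub>v x) / c\<^sup>2"
    by (simp add: power2_eq_square)
  with symmetric_spectral_radius_less_1_contraction[OF B symB srB x] c0
  have "(A *\<^sub>v x) \<bullet> (A *\<^sub>v x) \<le> c\<^sup>2 * (x \<bullet> x)"
    by (simp add: field_simps)
  then have "(A *\<^sub>v x) \<bullet> (A *\<^sub>v x) / (x \<bullet> x) \<le> c\<^sup>2"
    using scalar_prod_self_nonneg[of x]
    by (cases "x \<bullet> x = 0") (auto simp: divide_le_eq)
  then show "sqrt ((A *\<^sub>v x) \<bullet> (A *\<^sub>v x) / (x \<bullet> x)) \<le> c"
    using c0 by (intro real_le_lsqrt) auto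
qed

lemma level_matrix_carrier: "level_matrix T r v n \<in> carrier_mat n n"
  by (simp add: level_matrix_def)

lemma level_matrix_sym: "transpose_mat (level_matrix T r v n) = level_matrix T r v n"
  by (intro eq_matI) (auto simp: level_matrix_def abs_minus_commute)

text \<open>
  In matrix terms \<open>Q = A L\<close>, so the quotient in the theorem is \<open>\<parallel>A L\<parallel>\<^sup>2 / \<parallel>L\<parallel>\<^sup>2\<close>.
\<close>

lemma level_Q_vec:
  "level_matrix T r v n *\<^sub>v vec n (level_row_sum T r v n) = vec n (level_Q T r v n)"
  using level_matrix_carrier[of T r v n]
  by (intro eq_vecI) (auto simp: level_Q_def scalar_prod_def atLeast0LessThan)

lemma sum_level_Q:
  "(\<Sum>i<n. level_Q T r v n i) = (\<Sum>j<n. (level_row_sum T r v n j)\<^sup>2)"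
proof -
  let ?A = "level_matrix T r v n" and ?L = "level_row_sum T r v n"
  have "(\<Sum>i<n. level_Q T r v n i) = (\<Sum>j<n. \<Sum>i<n. ?A $$ (i, j) * ?L j)"
    unfolding level_Q_def by (rule sum.swap)
  also have "\<dots> = (\<Sum>j<n. \<Sum>i<n. ?A $$ (j, i) * ?L j)"
    by (intro sum.cong refl) (auto simp: level_matrix_def abs_minus_commute)
  also have "\<dots> = (\<Sum>j<n. (?L j)\<^sup>2)"
    by (simp add: level_row_sum_def power2_eq_square sum_distrib_right)
  finally show ?thesis .
qed

theorem theorem4:
  fixes T :: "('a, 'b) pre_digraph" and r :: 'a and v :: "nat \<Rightarrow> 'a" and n :: nat
  assumes "rooted_tree T r"
    and "bij_betw v {..<n} (verts T)"
    and "n \<ge> 2"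
  shows "level_spectral_radius T r v n
           \<ge> sqrt ((\<Sum>i<n. (level_Q T r v n i)\<^sup>2) / (\<Sum>j<n. (level_row_sum T r v n j)\<^sup>2))
       \<and> sqrt ((\<Sum>i<n. (level_Q T r v n i)\<^sup>2) / (\<Sum>j<n. (level_row_sum T r v n j)\<^sup>2))
           = sqrt ((\<Sum>i<n. (level_Q T r v n i)\<^sup>2) / (\<Sum>i<n. level_Q T r v n i))"
proof -
  let ?x = "vec n (level_row_sum T r v n)"
  have "sqrt ((vec n (level_Q T r v n) \<bullet> vec n (level_Q T r v n)) / (?x \<bullet> ?x))
          \<le> level_spectral_radius T r v n"
    using symmetric_spectral_radius_lower_bound[OF level_matrix_carrier level_matrix_sym, of n ?x T r v]
      \<open>n \<ge> 2\<close>
    by (simp add: level_Q_vec level_spectral_radius_def)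
  then show ?thesis
    by (simp add: sum_level_Q scalar_prod_def atLeast0LessThan power2_eq_square)
qed

end
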